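(* Let $q\ge 19$ be an odd prime and let $H$ be an integer with $\lfloor (q-1)/3\rfloor\le H\le (q-1)/2$. Let $\mathcal{C}$ be the conic $x_1^2=x_0x_2$, $\mathcal{V}_H=\{(1,i,i^2): i=0,1,\dots,H\}\subset\mathcal{C}$, $P=(0,1,0)$, $T_H=(0,1,b_H)$ where $b_H=2H+1$ if $H=\lfloor (q-1)/3\rfloor$ and $b_H=2H$ otherwise, $\mathcal{K}_H=\mathcal{V}_H\cup\{P,T_H\}$, and let $\ell_0$ be the line $x_0=0$. Then every point of $\ell_0\cup(\mathcal{C}\setminus\mathcal{V}_H)$ lies on a bisecant of $\mathcal{K}_H$.
   Context: Points of $PG(2,q)$ are in homogeneous coordinates $(x_0,x_1,x_2)$; integers are read in $F_q$. A bisecant of a point set $\mathcal{K}$ is a line through two distinct points of $\mathcal{K}$. *)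

theory Defs
  imports "HOL-Analysis.Cartesian_Space" "HOL-Computational_Algebra.Primes"
begin

text \<open>
  The projective plane over a field: points are the one-dimensional subspaces of the
  three-dimensional coordinate space, and a line is the set of all points contained in a fixed
  two-dimensional subspace. The vector components \<open>1, 2, 3\<close> are the
  homogeneous coordinates \<open>x0, x1, x2\<close>.
\<close>

definition pg_points :: "('a::field ^ 3) set set" where
  "pg_points = {p. vec.subspace p \<and> vec.dim p = 1}"

definition pg_lines :: "('a::field ^ 3) set set set" where
  "pg_lines = {{p \<in> pg_points. p \<subseteq> W} | W. vec.subspace W \<and> vec.dim W = 2}"

definition pg_point :: "'a::field \<Rightarrow> 'a \<Rightarrow> 'a \<Rightarrow> ('a ^ 3) set" where
  "pg_point x0 x1 x2 = vec.span {vector [x0, x1, x2]}"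

definition bisecant :: "('a::field ^ 3) set set \<Rightarrow> ('a ^ 3) set set \<Rightarrow> bool" where
  "bisecant K L \<longleftrightarrow> L \<in> pg_lines \<and> (\<exists>A\<in>K. \<exists>B\<in>K. A \<noteq> B \<and> A \<in> L \<and> B \<in> L)"

definition conic :: "('a::field ^ 3) set set" where
  "conic = {pg_point x0 x1 x2 | x0 x1 x2. (x0, x1, x2) \<noteq> (0, 0, 0) \<and> x1\<^sup>2 = x0 * x2}"

definition line_l0 :: "('a::field ^ 3) set set" where
  "line_l0 = {pg_point x0 x1 x2 | x0 x1 x2. (x0, x1, x2) \<noteq> (0, 0, 0) \<and> x0 = 0}"

definition V_set :: "nat \<Rightarrow> ('a::field ^ 3) set set" where
  "V_set H = {pg_point 1 (of_nat i) ((of_nat i)\<^sup>2) | i. i \<le> H}"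

definition P_pt :: "('a::field ^ 3) set" where
  "P_pt = pg_point 0 1 0"

definition b_coeff :: "nat \<Rightarrow> nat \<Rightarrow> nat" where
  "b_coeff q H = (if H = (q - 1) div 3 then 2 * H + 1 else 2 * H)"

definition T_pt :: "nat \<Rightarrow> nat \<Rightarrow> ('a::field ^ 3) set" where
  "T_pt q H = pg_point 0 1 (of_nat (b_coeff q H))"

definition K_set :: "nat \<Rightarrow> nat \<Rightarrow> ('a::field ^ 3) set set" where
  "K_set q H = V_set H \<union> {P_pt, T_pt q H}"

end

theory Submission
  imports Defs "HOL-Number_Theory.Residues"
begin

text \<open>
  The line \<open>x0 = 0\<close> joins \<open>P\<close> and \<open>T\<^sub>H\<close>, because \<open>0 < b\<^sub>H < q\<close>, and it contains the only
  point \<open>(0,0,1)\<close> of the conic that is not of the form \<open>(1,t,t\<^sup>2)\<close>. The line through \<open>(1,i,i\<^sup>2)\<close> and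
  \<open>(0,1,b)\<close> meets the conic again in the point with parameter \<open>t = b - i\<close>. Taking \<open>b = 0\<close>
  covers the parameters \<open>q - H, \<dots>, q - 1\<close>, and \<open>b = b\<^sub>H\<close> covers \<open>b\<^sub>H - H, \<dots>, b\<^sub>H\<close>. As
  \<open>b\<^sub>H - H \<le> H + 1\<close> and \<open>q - H \<le> b\<^sub>H + 1\<close>, every \<open>t > H\<close> is reached; the second inequality uses
  that 3 does not divide \<open>q\<close> when \<open>H = \<lfloor>(q - 1)/3\<rfloor>\<close>.
\<close>

lemma pg_point_in_pg_points:
  assumes "(w :: 'a::field ^ 3) \<noteq> 0"
  shows "vec.span {w} \<in> pg_points"
  unfolding pg_points_def using assms
  by (simp add: vec.dim_eq_card_independent vec.subspace_span)

text \<open>Reduces incidence to linear algebra: \<open>u\<close> and \<open>v\<close> are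
  independent, so they span the plane of a line, and a linear combination giving \<open>w\<close>
  puts its point on that line.\<close>

lemma bisecant_through:
  fixes u v w :: "'a::field ^ 3"
  assumes "u \<notin> vec.span {v}" "v \<noteq> 0" "w \<noteq> 0" "w = r *s u + s *s v"
    and "vec.span {u} \<in> K" "vec.span {v} \<in> K"
  shows "\<exists>L. bisecant K L \<and> vec.span {w} \<in> L"
proof -
  define W where "W = vec.span {u, v}"
  have ind: "vec.independent {u, v}" and "u \<noteq> v"
    using assms(1,2) by (auto simp: vec.independent_insert vec.span_base)
  then have W: "vec.subspace W" "vec.dim W = 2"
    unfolding W_def by (simp_all add: vec.dim_eq_card_independent vec.subspace_span)
  define L where "L = {p \<in> pg_points. p \<subseteq> W}"
  have L: "vec.span {x} \<in> L" if "x \<in> W" "x \<noteq> 0" for x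
    using that W(1) pg_point_in_pg_points[of x] vec.span_minimal[of "{x}" W]
    by (simp add: L_def)
  have "u \<in> W" "v \<in> W" by (auto simp: W_def vec.span_base)
  then have "w \<in> W"
    unfolding assms(4) W_def by (intro vec.span_add vec.span_scale)
  have "u \<noteq> 0" using assms(1) vec.span_zero by metis
  have "vec.span {u} \<noteq> vec.span {v}"
    using assms(1) vec.span_base[of u "{u}"] by auto
  moreover have "L \<in> pg_lines" using W by (auto simp: pg_lines_def L_def)
  ultimately have "bisecant K L"
    unfolding bisecant_def
    using assms(2,5,6) L \<open>u \<in> W\<close> \<open>v \<in> W\<close> \<open>u \<noteq> 0\<close> by blast
  then show ?thesis using L \<open>w \<in> W\<close> assms(3) by blast
qed

lemma vector_3_eq_0_iff:
  "(vector [a, b, c] :: 'a::zero ^ 3) = 0 \<longleftrightarrow> a = 0 \<and> b = 0 \<and> c = 0"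
  by (simp add: vec_eq_iff forall_3)

lemma pg_point_scale:
  assumes "(c::'a::field) \<noteq> 0"
  shows "pg_point (c * x) (c * y) (c * z) = pg_point x y z"
proof -
  have "vector [c * x, c * y, c * z] = c *s (vector [x, y, z] :: 'a ^ 3)"
    by (simp add: vec_eq_iff forall_3)
  then show ?thesis
    using vec.span_image_scale[of "{vector [x, y, z]}" "\<lambda>_. c"] assms
    by (simp add: pg_point_def)
qed

text \<open>If \<open>x \<noteq> 0\<close>, dividing by \<open>x\<close> gives
  \<open>t = y / x\<close>, and the conic equation turns \<open>z / x\<close> into
  \<open>t\<^sup>2\<close>.\<close>

lemma conic_cases:
  assumes "X \<in> (conic :: ('a::field ^ 3) set set)"
  obtains "X \<in> line_l0" | t where "X = pg_point 1 t (t\<^sup>2)"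
proof -
  obtain x y z where X: "X = pg_point x y z" "(x, y, z) \<noteq> (0, 0, 0)" "y\<^sup>2 = x * z"
    using assms by (auto simp: conic_def)
  show thesis
  proof (cases "x = 0")
    case True
    then show ?thesis using X that(1) by (auto simp: line_l0_def)
  next
    case False
    have "X = pg_point (x * 1) (x * (y / x)) (x * (y / x)\<^sup>2)"
      using False X by (simp add: power2_eq_square field_simps)
    then show ?thesis using that(2) pg_point_scale[OF False] by metis
  qed
qed

lemma line_l0_on_bisecant:
  fixes b :: "'a::field"
  assumes "X \<in> line_l0" "b \<noteq> 0" "pg_point 0 1 0 \<in> K" "pg_point 0 1 b \<in> K"
  shows "\<exists>L. bisecant K L \<and> X \<in> L"
proof -
  obtain y z where X: "X = pg_point 0 y z" "(y, z) \<noteq> (0, 0)"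
    using assms(1) by (auto simp: line_l0_def)
  show ?thesis
    unfolding X(1) pg_point_def
  proof (rule bisecant_through)
    show "vector [0, 1, b] \<notin> vec.span {vector [0, 1, 0] :: 'a ^ 3}"
      using assms(2) by (auto simp: vec.span_singleton vec_eq_iff forall_3)
    show "vector [0, y, z] = (z / b) *s vector [0, 1, b] + (y - z / b) *s (vector [0, 1, 0] :: 'a ^ 3)"
      using assms(2) by (simp add: vec_eq_iff forall_3)
  qed (use assms(3,4) X in \<open>auto simp: pg_point_def vector_3_eq_0_iff\<close>)
qed

lemma conic_point_on_bisecant:
  fixes b t i :: "'a::field"
  assumes "t + i = b" "pg_point 1 i (i\<^sup>2) \<in> K" "pg_point 0 1 b \<in> K"
  shows "\<exists>L. bisecant K L \<and> pg_point 1 t (t\<^sup>2) \<in> L"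
  unfolding pg_point_def
proof (rule bisecant_through)
  show "vector [1, i, i\<^sup>2] \<notin> vec.span {vector [0, 1, b] :: 'a ^ 3}"
    by (auto simp: vec.span_singleton vec_eq_iff forall_3)
  \<comment> \<open>The last coordinate is \<open>t\<^sup>2 - i\<^sup>2 = (t - i) * (t + i)\<close>
    with \<open>t + i = b\<close>; the case \<open>t = i\<close> is allowed.\<close>
  show "vector [1, t, t\<^sup>2] = 1 *s vector [1, i, i\<^sup>2] + (t - i) *s (vector [0, 1, b] :: 'a ^ 3)"
    unfolding assms(1)[symmetric]
    by (simp add: vec_eq_iff forall_3 power2_eq_square algebra_simps)
qed (use assms in \<open>auto simp: pg_point_def vector_3_eq_0_iff\<close>)

lemma CHAR_eq_CARD_of_prime:
  assumes "prime CARD('a::{field,finite})"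
  shows "CHAR('a) = CARD('a)"
  using assms CHAR_dvd_CARD[where 'a = 'a] CHAR_not_1[where 'a = 'a] by (auto simp: prime_nat_iff)

text \<open>\<open>of_nat\<close> is injective below the characteristic, which equals the order of
  the field, so counting makes it surjective.\<close>

lemma of_nat_surj_prime_field:
  assumes "prime CARD('a::{field,finite})"
  obtains n where "n < CARD('a)" "(t::'a) = of_nat n"
proof -
  have "inj_on (of_nat :: nat \<Rightarrow> 'a) {..<CARD('a)}"
    using CHAR_eq_CARD_of_prime[OF assms]
    by (auto simp: inj_on_def of_nat_eq_iff_cong_CHAR cong_def)
  then have "of_nat ` {..<CARD('a)} = (UNIV :: 'a set)"
    by (intro card_subset_eq) (simp_all add: card_image)
  then show ?thesis using that by (metis UNIV_I image_iff lessThan_iff)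
qed

lemma b_coeff_bounds:
  assumes "prime q" "3 < q" "(q - 1) div 3 \<le> H" "H \<le> (q - 1) div 2"
  shows "0 < b_coeff q H" "b_coeff q H < q"
    and "b_coeff q H \<le> 2 * H + 1" "q \<le> b_coeff q H + H + 1"
proof -
  have "\<not> 3 dvd q"
    using assms(1,2) by (auto simp: prime_nat_iff)
  \<comment> \<open>The remainder of \<open>q - 1\<close> modulo 3 is 0 or 1, not 2. The extra 1 in
    \<open>b_coeff\<close> at the smallest \<open>H\<close> then just suffices:
    \<open>b + H + 1 = 3 * H + 2\<close>.\<close>
  then have "q \<le> 3 * ((q - 1) div 3) + 2"
    using assms(2) by presburger
  then show "q \<le> b_coeff q H + H + 1"
    using assms(3) by (simp add: b_coeff_def)
  show "0 < b_coeff q H" "b_coeff q H < q" "b_coeff q H \<le> 2 * H + 1"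
    using assms(2-4) unfolding b_coeff_def by (cases "H = (q - 1) div 3"; simp; linarith)+
qed

theorem theorem10:
  fixes q H :: nat
    and X :: "('a::{field,finite} ^ 3) set"
  assumes "prime q" and "odd q" and "19 \<le> q"
    and "CARD('a) = q"
    and "(q - 1) div 3 \<le> H" and "H \<le> (q - 1) div 2"
    and "X \<in> line_l0 \<union> (conic - V_set H)"
  shows "\<exists>L. bisecant (K_set q H) L \<and> X \<in> L"
proof -
  define b where "b = b_coeff q H"
  have b: "0 < b" "b < q" "b \<le> 2 * H + 1" "q \<le> b + H + 1"
    using b_coeff_bounds[of q H] assms by (simp_all add: b_def)
  have char: "CHAR('a) = q"
    using CHAR_eq_CARD_of_prime[where 'a = 'a] assms by simp
  have K: "pg_point 0 1 0 \<in> K_set q H" "pg_point 0 1 (of_nat b :: 'a) \<in> K_set q H"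
    by (simp_all add: K_set_def P_pt_def T_pt_def b_def)
  have V: "pg_point 1 (of_nat i) ((of_nat i)\<^sup>2) \<in> (V_set H :: ('a ^ 3) set set)" if "i \<le> H" for i
    using that by (auto simp: V_set_def)
  then have VK: "pg_point 1 (of_nat i) ((of_nat i)\<^sup>2) \<in> (K_set q H :: ('a ^ 3) set set)"
    if "i \<le> H" for i
    using that by (simp add: K_set_def)
  have "(of_nat b :: 'a) \<noteq> 0"
    using b by (simp add: of_nat_eq_0_iff_char_dvd char nat_dvd_not_less)
  then have l0: ?thesis if "X \<in> line_l0"
    using line_l0_on_bisecant that K by blast
  show ?thesis
  proof (cases "X \<in> line_l0")
    case False
    then obtain t where X: "X = pg_point 1 t (t\<^sup>2)"
      using assms(7) conic_cases by blast
    obtain n where n: "n < q" "t = of_nat n"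
      using of_nat_surj_prime_field[of t] assms by auto
    have "H < n"
      using assms(7) False V[of n] by (fastforce simp: X n(2))
    show ?thesis
    proof (cases "n \<le> b")
      case True
      \<comment> \<open>Bisecant through \<open>T_pt\<close>: \<open>b - n \<le> H\<close> because
        \<open>b \<le> 2 * H + 1\<close> and \<open>n \<ge> H + 1\<close>.\<close>
      have "t + of_nat (b - n) = of_nat b"
        unfolding n(2) of_nat_add[symmetric] using True by simp
      then show ?thesis
        unfolding X using VK[of "b - n"] K(2) b \<open>H < n\<close>
        by (intro conic_point_on_bisecant) auto
    next
      case False
      \<comment> \<open>Bisecant through \<open>P_pt\<close>, the case of slope 0:
        \<open>n \<ge> b + 1\<close> gives \<open>q - n \<le> q - b - 1 \<le> H\<close>, and
        \<open>q\<close> vanishes in the field.\<close>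
      have "t + of_nat (q - n) = of_nat q"
        unfolding n(2) of_nat_add[symmetric] using n by simp
      then have "t + of_nat (q - n) = 0"
        by (simp add: of_nat_eq_0_iff_char_dvd char)
      then show ?thesis
        unfolding X using VK[of "q - n"] K(1) b False
        by (intro conic_point_on_bisecant) auto
    qed
  qed (rule l0)
qed

end
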